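(* The construction of a Poincaré map is functorial for $\mathbf{WFlowGS}$. That is, there exists a functor $P: \mathbf{WFlowGS} \to \mathbf{Map}$ defined by setting: (i) $P(\Phi, X, S) = (P\Phi, S)$ for each object $(\Phi, X, S)$ of $\mathbf{WFlowGS}$; (ii) for each morphism $(h,\tau):(\Phi_1, X_1, S_1) \to (\Phi_2, X_2, S_2)$ of $\mathbf{WFlowGS}$, $P(h,\tau) = h|_{S_1}: (P\Phi_1, S_1) \to (P\Phi_2, S_2)$.
   Context: Topological manifolds are assumed second countable and Hausdorff. Map dynamical systems. $\mathbf{Map}$ is the category whose objects are pairs $(f,X)$ with $X$ a topological manifold without boundary and $f:X\to X$ a homeomorphism, and whose morphisms $h:(f,X)\to(g,Y)$ are continuous maps $h:X\to Y$ with $h\circ f=g\circ h$. Flows. A flow $(\Phi,X)$ is a topological manifold $X$ without boundary together with a continuous map $\Phi: X\times\mathbb{R}\to X$ with $\Phi(x,0)=x$ and $\Phi(\Phi(x,t),s)=\Phi(x,t+s)$. A weak morphism $(h,\tau):(\Phi,X)\to(\Psi,Y)$ is a pair of a continuous map $h:X\to Y$ and a map $\tau:X\times\mathbb{R}\to\mathbb{R}$ such that $h(\Phi(x,t))=\Psi(h(x),\tau(x,t))$ for all $x,t$, and for each $x\in X$, $\tau(x,-):\mathbb{R}\to\mathbb{R}$ is an increasing homeomorphism with $\tau(x,0)=0$. Composition is $(h_2,\tau_2)\circ(h_1,\tau_1)=(h_2\circ h_1,\tau_2\circ\tau_1)$ with $\tau_2\circ\tau_1(x,t):=\tau_2(h_1(x),\tau_1(x,t))$.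 Sections. Let $X$ be $n$-dimensional. A submanifold $S\subset X$ without boundary is topologically transversal to $\Phi$ if: (1) $S$ is of codimension one and locally flat. (2) For each $x\in S$ there exist a neighborhood $U$ of $x$ in $X$ and a homeomorphism $\phi:U\to B\subset\mathbb{R}^n$, where $B$ is the unit ball, such that $\phi(U\cap S)=B\cap(\mathbb{R}^{n-1}\times\{0\})$. Further, there exist $\delta_+(x)>0$ and $\delta_-(x)<0$ such that $\Phi(x,[\delta_-(x),0))$ and $\Phi(x,(0,\delta_+(x)])$ are contained in different connected components of $U\setminus S$ and $\Phi(x,[\delta_-(x),\delta_+(x)])\cap S=\{x\}$. Here $\delta_+$ and $\delta_-$ can be taken locally uniformly, that is, there exist a neighborhood $V\subset U$ of $x$ and $\delta>0$ such that $\delta_+(y)>\delta$ and $\delta_-(y)<-\delta$ for all $y\in V\cap S$. (3) For each set of the form $\Phi(y,[a,b])$, where $y\in X$ and $a,b\in\mathbb{R}$, $\Phi(y,[a,b])\cap S$ is compact in $S$. A submanifold $S\subset X$ is a global Poincaré section if $S$ is topologically transversal to $\Phi$ and for each $x\in X$ there exist $t_+>0$ and $t_-<0$ with $\Phi(x,t_+)\in S$ and $\Phi(x,t_-)\in S$. Poincaré map. For a global Poincaré section $S$ and $x\in S$, $T_\Phi(x)>0$ is the first return time, i.e. the smallest $t>0$ with $\Phi(x,t)\in S$, and $P\Phi:S\to S$ is the Poincaré map $P\Phi(x)=\Phi(x,T_\Phi(x))$. The category $\mathbf{WFlowGS}$ has as objects triples $(\Phi,X,S)$ with $(\Phi,X)$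 a flow and $S$ a global Poincaré section, and as morphisms $(\Phi,X,S)\to(\Psi,Y,S')$ the weak morphisms $(h,\tau):(\Phi,X)\to(\Psi,Y)$ which preserve the sections, i.e. $S=h^{-1}(S')$.
   Formalization: The section S is additionally required to be a closed subset of X; without this the Poincaré map can be discontinuous, e.g. rotation flow on R × S¹ with S = R×{0} ∪ (0,∞)×{1}. *)

theory Defs
  imports "HOL-Analysis.Analysis"
begin

section \<open>Categories and functors\<close>

text \<open>
  A category is given by a set of objects and Hom-sets indexed by pairs of objects.  Hom-sets for
  different pairs need not be disjoint, so \<open>Comp\<close> and the arrow part of a functor also take
  the objects involved: \<open>Comp C A B D g f\<close> is the composite of
  \<open>f \<in> Hom C A B\<close> and \<open>g \<in> Hom C B D\<close>.
\<close>

record ('o, 'm) cat =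
  Obj :: "'o set"
  Hom :: "'o \<Rightarrow> 'o \<Rightarrow> 'm set"
  Id :: "'o \<Rightarrow> 'm"
  Comp :: "'o \<Rightarrow> 'o \<Rightarrow> 'o \<Rightarrow> 'm \<Rightarrow> 'm \<Rightarrow> 'm"

definition is_category :: "('o, 'm) cat \<Rightarrow> bool" where
  "is_category C \<longleftrightarrow>
     (\<forall>A \<in> Obj C. Id C A \<in> Hom C A A) \<and>
     (\<forall>A \<in> Obj C. \<forall>B \<in> Obj C. \<forall>D \<in> Obj C. \<forall>f \<in> Hom C A B. \<forall>g \<in> Hom C B D.
        Comp C A B D g f \<in> Hom C A D) \<and>
     (\<forall>A \<in> Obj C. \<forall>B \<in> Obj C. \<forall>f \<in> Hom C A B.
        Comp C A A B f (Id C A) = f \<and> Comp C A B B (Id C B) f = f) \<and>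
     (\<forall>A \<in> Obj C. \<forall>B \<in> Obj C. \<forall>D \<in> Obj C. \<forall>E \<in> Obj C.
        \<forall>f \<in> Hom C A B. \<forall>g \<in> Hom C B D. \<forall>k \<in> Hom C D E.
          Comp C A D E k (Comp C A B D g f) = Comp C A B E (Comp C B D E k g) f)"

record ('o, 'm, 'p, 'n) func =
  obj_map :: "'o \<Rightarrow> 'p"
  hom_map :: "'o \<Rightarrow> 'o \<Rightarrow> 'm \<Rightarrow> 'n"

definition is_functor :: "('o, 'm) cat \<Rightarrow> ('p, 'n) cat \<Rightarrow> ('o, 'm, 'p, 'n) func \<Rightarrow> bool" where
  "is_functor C D F \<longleftrightarrow>
     is_category C \<and> is_category D \<and>
     (\<forall>A \<in> Obj C. obj_map F A \<in> Obj D) \<and>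
     (\<forall>A \<in> Obj C. \<forall>B \<in> Obj C. \<forall>f \<in> Hom C A B.
        hom_map F A B f \<in> Hom D (obj_map F A) (obj_map F B)) \<and>
     (\<forall>A \<in> Obj C. hom_map F A A (Id C A) = Id D (obj_map F A)) \<and>
     (\<forall>A \<in> Obj C. \<forall>B \<in> Obj C. \<forall>E \<in> Obj C. \<forall>f \<in> Hom C A B. \<forall>g \<in> Hom C B E.
        hom_map F A E (Comp C A B E g f) =
        Comp D (obj_map F A) (obj_map F B) (obj_map F E) (hom_map F B E g) (hom_map F A B f))"

section \<open>Topological manifolds\<close>

definition manifold_of_dim :: "nat \<Rightarrow> 'a topology \<Rightarrow> bool" where
  "manifold_of_dim n X \<longleftrightarrow>
     Hausdorff_space X \<and> second_countable X \<and>
     (\<forall>x \<in> topspace X. \<exists>U V. openin X U \<and> x \<in> U \<and> openin (Euclidean_space n) V \<and>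
        subtopology X U homeomorphic_space subtopology (Euclidean_space n) V)"

definition topological_manifold :: "'a topology \<Rightarrow> bool" where
  "topological_manifold X \<longleftrightarrow> (\<exists>n. manifold_of_dim n X)"

text \<open>
  Submanifolds (without boundary) carry the subspace topology and are properly embedded, that is,
  closed as subsets.  Closedness matters: on the cylinder \<open>\<real> \<times> (\<real>/2\<pi>\<int>)\<close>
  with the flow \<open>((r, \<theta>), t) \<mapsto> (r, \<theta> + t)\<close>, the non-closed set
  \<open>S = (\<real> \<times> {0}) \<union> ({0<..} \<times> {1})\<close> satisfies every other requirement on a
  global Poincare section, but its first return map sends \<open>(r, 0)\<close> to \<open>(r, 0)\<close>
  for \<open>r \<le> 0\<close> and to \<open>(r, 1)\<close> for \<open>r > 0\<close>, so it is not continuous.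
\<close>

definition submanifold_of_dim :: "nat \<Rightarrow> 'a topology \<Rightarrow> 'a set \<Rightarrow> bool" where
  "submanifold_of_dim k X S \<longleftrightarrow> closedin X S \<and> manifold_of_dim k (subtopology X S)"

text \<open>
  The carrier of \<open>Euclidean_space n\<close> consists of the real sequences vanishing from index
  \<open>n\<close> on, so the carrier of \<open>Euclidean_space k\<close>, for \<open>k \<le> n\<close>, is literally
  the subspace \<open>\<real>\<^sup>k \<times> {0}\<close> of \<open>\<real>\<^sup>n\<close>.
\<close>

definition locally_flat :: "nat \<Rightarrow> nat \<Rightarrow> 'a topology \<Rightarrow> 'a set \<Rightarrow> bool" where
  "locally_flat n k X S \<longleftrightarrow>
     (\<forall>x \<in> S. \<exists>U \<phi>. openin X U \<and> x \<in> U \<and>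
        homeomorphic_map (subtopology X U) (Euclidean_space n) \<phi> \<and>
        \<phi> ` (U \<inter> S) = topspace (Euclidean_space k))"

definition unit_ball :: "nat \<Rightarrow> (nat \<Rightarrow> real) set" where
  "unit_ball n = {v \<in> topspace (Euclidean_space n). (\<Sum>i<n. (v i)\<^sup>2) < 1}"

section \<open>Map dynamical systems\<close>

text \<open>
  In all categories below, the maps belonging to objects and morphisms are extensional, i.e. fixed
  to be \<open>undefined\<close> outside their domain, so that equality of HOL functions is equality of
  maps between the spaces.
\<close>

type_synonym 'a map_system = "('a \<Rightarrow> 'a) \<times> 'a topology"

definition MapDS :: "('a map_system, 'a \<Rightarrow> 'a) cat" where
  "MapDS = \<lparr>
     Obj = {(f, X). topological_manifold X \<and> f \<in> extensional (topspace X) \<and>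
                    homeomorphic_map X X f},
     Hom = (\<lambda>(f, X) (g, Y). {h \<in> extensional (topspace X).
                    continuous_map X Y h \<and> (\<forall>x \<in> topspace X. h (f x) = g (h x))}),
     Id = (\<lambda>(f, X). \<lambda>x \<in> topspace X. x),
     Comp = (\<lambda>(f, X) _ _ h\<^sub>2 h\<^sub>1. compose (topspace X) h\<^sub>2 h\<^sub>1) \<rparr>"

section \<open>Flows, weak morphisms and global Poincare sections\<close>

definition is_flow :: "('a \<times> real \<Rightarrow> 'a) \<Rightarrow> 'a topology \<Rightarrow> bool" where
  "is_flow \<Phi> X \<longleftrightarrow>
     topological_manifold X \<and>
     \<Phi> \<in> extensional (topspace X \<times> UNIV) \<and>
     continuous_map (prod_topology X euclideanreal) X \<Phi> \<and>
     (\<forall>x \<in> topspace X. \<Phi> (x, 0) = x) \<and>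
     (\<forall>x \<in> topspace X. \<forall>t s. \<Phi> (\<Phi> (x, t), s) = \<Phi> (x, t + s))"

definition weak_morphism ::
  "('a \<times> real \<Rightarrow> 'a) \<Rightarrow> 'a topology \<Rightarrow> ('b \<times> real \<Rightarrow> 'b) \<Rightarrow> 'b topology \<Rightarrow>
   ('a \<Rightarrow> 'b) \<Rightarrow> ('a \<times> real \<Rightarrow> real) \<Rightarrow> bool" where
  "weak_morphism \<Phi> X \<Psi> Y h \<tau> \<longleftrightarrow>
     h \<in> extensional (topspace X) \<and> \<tau> \<in> extensional (topspace X \<times> UNIV) \<and>
     continuous_map X Y h \<and>
     (\<forall>x \<in> topspace X. \<forall>t. h (\<Phi> (x, t)) = \<Psi> (h x, \<tau> (x, t))) \<and>
     (\<forall>x \<in> topspace X.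
        strict_mono (\<lambda>t. \<tau> (x, t)) \<and>
        homeomorphic_map euclideanreal euclideanreal (\<lambda>t. \<tau> (x, t)) \<and>
        \<tau> (x, 0) = 0)"

text \<open>
  In the second condition, \<open>\<delta>\<^sub>+\<close> and \<open>\<delta>\<^sub>-\<close> are functions on
  \<open>S\<close>, since the local uniformity clause compares their values at nearby points of
  \<open>S\<close>.
\<close>

definition topologically_transversal ::
  "nat \<Rightarrow> ('a \<times> real \<Rightarrow> 'a) \<Rightarrow> 'a topology \<Rightarrow> 'a set \<Rightarrow> bool" where
  "topologically_transversal n \<Phi> X S \<longleftrightarrow>
     (\<exists>k. n = k + 1 \<and> submanifold_of_dim k X S \<and> locally_flat n k X S) \<and>
     (\<exists>\<delta>\<^sub>p \<delta>\<^sub>m. \<forall>x \<in> S. \<delta>\<^sub>p x > (0::real) \<and> \<delta>\<^sub>m x < (0::real) \<and>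
        (\<exists>U \<phi>. openin X U \<and> x \<in> U \<and>
           homeomorphic_map (subtopology X U)
             (subtopology (Euclidean_space n) (unit_ball n)) \<phi> \<and>
           \<phi> ` (U \<inter> S) = unit_ball n \<inter> topspace (Euclidean_space (n - 1)) \<and>
           (\<exists>C \<in> connected_components_of (subtopology X (U - S)).
            \<exists>D \<in> connected_components_of (subtopology X (U - S)).
              C \<noteq> D \<and>
              \<Phi> ` ({x} \<times> {\<delta>\<^sub>m x..<0}) \<subseteq> C \<and>
              \<Phi> ` ({x} \<times> {0<..\<delta>\<^sub>p x}) \<subseteq> D) \<and>
           \<Phi> ` ({x} \<times> {\<delta>\<^sub>m x..\<delta>\<^sub>p x}) \<inter> S = {x} \<and>
           (\<exists>V \<delta>. openin X V \<and> x \<in> V \<and> V \<subseteq> U \<and> \<delta> > 0 \<and>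
              (\<forall>y \<in> V \<inter> S. \<delta>\<^sub>p y > \<delta> \<and> \<delta>\<^sub>m y < - \<delta>)))) \<and>
     (\<forall>y \<in> topspace X. \<forall>a b. compactin (subtopology X S) (\<Phi> ` ({y} \<times> {a..b}) \<inter> S))"

definition global_section :: "('a \<times> real \<Rightarrow> 'a) \<Rightarrow> 'a topology \<Rightarrow> 'a set \<Rightarrow> bool" where
  "global_section \<Phi> X S \<longleftrightarrow>
     (\<exists>n. manifold_of_dim n X \<and> topologically_transversal n \<Phi> X S) \<and>
     (\<forall>x \<in> topspace X. (\<exists>t>0. \<Phi> (x, t) \<in> S) \<and> (\<exists>t<0. \<Phi> (x, t) \<in> S))"

definition first_return_time :: "('a \<times> real \<Rightarrow> 'a) \<Rightarrow> 'a set \<Rightarrow> 'a \<Rightarrow> real" where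
  "first_return_time \<Phi> S x = (LEAST t. t > 0 \<and> \<Phi> (x, t) \<in> S)"

definition poincare_map :: "('a \<times> real \<Rightarrow> 'a) \<Rightarrow> 'a set \<Rightarrow> 'a \<Rightarrow> 'a" where
  "poincare_map \<Phi> S = (\<lambda>x \<in> S. \<Phi> (x, first_return_time \<Phi> S x))"

type_synonym 'a sectioned_flow = "('a \<times> real \<Rightarrow> 'a) \<times> 'a topology \<times> 'a set"

type_synonym 'a flow_arrow = "('a \<Rightarrow> 'a) \<times> ('a \<times> real \<Rightarrow> real)"

definition WFlowGS :: "('a sectioned_flow, 'a flow_arrow) cat" where
  "WFlowGS = \<lparr>
     Obj = {(\<Phi>, X, S). is_flow \<Phi> X \<and> global_section \<Phi> X S},
     Hom = (\<lambda>(\<Phi>, X, S) (\<Psi>, Y, S'). {(h, \<tau>). weak_morphism \<Phi> X \<Psi> Y h \<tau> \<and>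
                    S = {x \<in> topspace X. h x \<in> S'}}),
     Id = (\<lambda>(\<Phi>, X, S). (\<lambda>x \<in> topspace X. x, \<lambda>(x, t) \<in> topspace X \<times> UNIV. t)),
     Comp = (\<lambda>(\<Phi>, X, S) _ _ (h\<^sub>2, \<tau>\<^sub>2) (h\<^sub>1, \<tau>\<^sub>1).
               (compose (topspace X) h\<^sub>2 h\<^sub>1,
                \<lambda>(x, t) \<in> topspace X \<times> UNIV. \<tau>\<^sub>2 (h\<^sub>1 x, \<tau>\<^sub>1 (x, t)))) \<rparr>"

end

theory Submission
  imports Defs
begin

text \<open>
  The categorical laws are bookkeeping with extensional functions, so the content lies in two facts.

  \<^item> The Poincare map is a homeomorphism of the section \<open>S\<close>.  The first return time \<open>T\<close> is
    attained, because \<open>S\<close> is closed and points of an orbit cannot return to \<open>S\<close> arbitrarily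
    soon.  It is continuous on \<open>S\<close>: an orbit segment that starts near \<open>x\<close> stays off the closed
    set \<open>S\<close> as long as the one of \<open>x\<close> does, and for short times by the local uniformity of
    \<open>\<delta>\<^sub>+\<close>, so \<open>T\<close> cannot drop; and the orbit of \<open>x\<close> passes at time \<open>T x\<close> from one component
    of \<open>U - S\<close> to another, so nearby orbits must cross \<open>S\<close> at nearly the same time, and \<open>T\<close>
    cannot jump up.  These two halves are \<open>first_return_time_lsc\<close> and
    \<open>first_return_time_usc\<close>; the second rests on the openness of the two components, which
    holds because manifolds are locally connected (\<open>global_section_cross_section\<close>).  The
    conditions on \<open>S\<close> are symmetric under time reversal, and the
    Poincare map of the reversed flow is the inverse (\<open>poincare_map_reverse\<close>).

  \<^item> A section preserving weak morphism commutes with the Poincare maps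
    (\<open>weak_morphism_poincare\<close>): it carries orbits to orbits by increasing reparametrisations,
    and since \<open>S\<close> is the full preimage of \<open>S'\<close>, it carries the first return to the first return.
\<close>

section \<open>Manifolds are locally connected\<close>

lemma locally_connected_space_open_cover:
  assumes "\<And>x. x \<in> topspace X \<Longrightarrow>
    \<exists>U. openin X U \<and> x \<in> U \<and> locally_connected_space (subtopology X U)"
  shows "locally_connected_space X"
  unfolding locally_connected_space
proof (intro allI impI)
  fix V x assume V: "openin X V \<and> x \<in> V"
  then have "x \<in> topspace X" using openin_subset by blast
  then obtain U where U: "openin X U" "x \<in> U" "locally_connected_space (subtopology X U)"
    using assms by blast
  have "openin (subtopology X U) (U \<inter> V)" "x \<in> U \<inter> V"
    using U V by (auto simp: openin_open_subtopology openin_Int)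
  then obtain W where "openin (subtopology X U) W" "connectedin (subtopology X U) W"
      "x \<in> W" "W \<subseteq> U \<inter> V"
    using U(3) unfolding locally_connected_space by meson
  then show "\<exists>W. openin X W \<and> connectedin X W \<and> x \<in> W \<and> W \<subseteq> V"
    using U(1) by (auto simp: openin_open_subtopology connectedin_subtopology)
qed

lemma manifold_of_dim_locally_connected:
  assumes "manifold_of_dim n X"
  shows "locally_connected_space X"
proof (rule locally_connected_space_open_cover)
  fix x assume "x \<in> topspace X"
  then obtain U V where U: "openin X U" "x \<in> U" "openin (Euclidean_space n) V"
      "subtopology X U homeomorphic_space subtopology (Euclidean_space n) V"
    using assms unfolding manifold_of_dim_def by blast
  then have "locally_connected_space (subtopology (Euclidean_space n) V)"
    by (simp add: locally_connected_Euclidean_space locally_connected_space_open_subset)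
  then show "\<exists>U. openin X U \<and> x \<in> U \<and> locally_connected_space (subtopology X U)"
    using U homeomorphic_locally_connected_space by blast
qed

section \<open>Cross sections of a flow\<close>

lemma first_return_time_eqI:
  assumes "t > 0" "\<Phi> (x, t) \<in> S" "\<And>s. \<lbrakk>0 < s; s < t\<rbrakk> \<Longrightarrow> \<Phi> (x, s) \<notin> S"
  shows "first_return_time \<Phi> S x = t"
  unfolding first_return_time_def
  by (rule Least_equality) (use assms in \<open>force simp: not_less [symmetric]\<close>)+

text \<open>
  What the Poincare map sees of a global section.  In \<open>crossing\<close> the orbit of \<open>x\<close> changes from one
  part of an open partition of \<open>U - S\<close> to the other: two disjoint open sets are what it takes to
  contradict the connectedness of an orbit segment that fails to meet \<open>S\<close>.  The bound \<open>\<delta>\<close> in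
  \<open>isolated\<close> serves a whole neighbourhood in \<open>S\<close>, which keeps return times from collapsing to
  \<open>0\<close> near \<open>x\<close>.  Both conditions are invariant under time reversal, so that every result about
  the Poincare map holds for its inverse as well.
\<close>

locale cross_section =
  fixes \<Phi> :: "'a \<times> real \<Rightarrow> 'a" and X :: "'a topology" and S :: "'a set"
  assumes flow_continuous: "continuous_map (prod_topology X euclideanreal) X \<Phi>"
    and flow_0: "x \<in> topspace X \<Longrightarrow> \<Phi> (x, 0) = x"
    and flow_add: "x \<in> topspace X \<Longrightarrow> \<Phi> (\<Phi> (x, t), s) = \<Phi> (x, t + s)"
    and section_closed: "closedin X S"
    and isolated: "x \<in> S \<Longrightarrow> \<exists>V \<delta>. openin X V \<and> x \<in> V \<and> \<delta> > 0 \<and>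
      (\<forall>y \<in> V \<inter> S. \<forall>t. t \<noteq> 0 \<and> \<bar>t\<bar> \<le> \<delta> \<longrightarrow> \<Phi> (y, t) \<notin> S)"
    and crossing: "x \<in> S \<Longrightarrow> \<exists>U A B \<epsilon>. openin X U \<and> x \<in> U \<and> openin X A \<and> openin X B \<and>
      A \<inter> B = {} \<and> U - S = A \<union> B \<and> \<epsilon> > 0 \<and>
      (\<forall>t. - \<epsilon> \<le> t \<and> t < 0 \<longrightarrow> \<Phi> (x, t) \<in> A) \<and> (\<forall>t. 0 < t \<and> t \<le> \<epsilon> \<longrightarrow> \<Phi> (x, t) \<in> B)"
    and forward_return: "x \<in> topspace X \<Longrightarrow> \<exists>t>0. \<Phi> (x, t) \<in> S"
    and backward_return: "x \<in> topspace X \<Longrightarrow> \<exists>t<0. \<Phi> (x, t) \<in> S"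
begin

lemma section_subset: "S \<subseteq> topspace X"
  using section_closed closedin_subset by blast

lemma flow_in_topspace: "x \<in> topspace X \<Longrightarrow> \<Phi> (x, t) \<in> topspace X"
  using flow_continuous by (auto simp: continuous_map_def Pi_iff)

lemma orbit_continuous:
  assumes "x \<in> topspace X" shows "continuous_map euclideanreal X (\<lambda>t. \<Phi> (x, t))"
proof -
  have "continuous_map euclideanreal (prod_topology X euclideanreal) (\<lambda>t. (x, t))"
    using assms by (simp add: continuous_map_pairedI)
  then show ?thesis
    using continuous_map_compose [OF _ flow_continuous] by (simp add: o_def)
qed

text \<open>The tube lemma: orbit segments over a compact time set depend continuously on the start.\<close>

lemma orbit_tube:
  assumes "x \<in> topspace X" "compact K" "openin X W" "\<And>t. t \<in> K \<Longrightarrow> \<Phi> (x, t) \<in> W"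
  obtains N where "openin X N" "x \<in> N" "\<And>y t. \<lbrakk>y \<in> N; t \<in> K\<rbrakk> \<Longrightarrow> \<Phi> (y, t) \<in> W"
proof -
  let ?W = "{p \<in> topspace (prod_topology X euclideanreal). \<Phi> p \<in> W}"
  have "openin (prod_topology X euclideanreal) ?W"
    by (rule openin_continuous_map_preimage [OF flow_continuous assms(3)])
  moreover have "{x} \<times> K \<subseteq> ?W" using assms by auto
  ultimately obtain N V where NV: "openin X N" "x \<in> N" "K \<subseteq> V" "N \<times> V \<subseteq> ?W"
    using tube_lemma_right [of X euclideanreal ?W K x] assms(1,2) by auto
  show thesis
    by (rule that [OF NV(1,2)]) (use NV(3,4) in blast)
qed

lemma first_return:
  assumes x: "x \<in> S"
  shows "first_return_time \<Phi> S x > 0"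
    and "\<Phi> (x, first_return_time \<Phi> S x) \<in> S"
    and "\<And>s. \<lbrakk>0 < s; s < first_return_time \<Phi> S x\<rbrakk> \<Longrightarrow> \<Phi> (x, s) \<notin> S"
proof -
  have xX: "x \<in> topspace X" using x section_subset by blast
  obtain t0 where t0: "t0 > 0" "\<Phi> (x, t0) \<in> S" using forward_return [OF xX] by blast
  obtain \<delta> where \<delta>: "\<delta> > 0" "\<And>t. \<lbrakk>t \<noteq> 0; \<bar>t\<bar> \<le> \<delta>\<rbrakk> \<Longrightarrow> \<Phi> (x, t) \<notin> S"
    using isolated [OF x] x by blast
  (* Bounding the return times away from 0 makes the set of candidates compact. *)
  let ?K = "{\<delta>..t0} \<inter> {t. \<Phi> (x, t) \<in> S}"
  have "closed {t. \<Phi> (x, t) \<in> S}"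
    using closedin_continuous_map_preimage [OF orbit_continuous [OF xX] section_closed] by simp
  then have "compact ?K" by (intro compact_Int_closed) auto
  moreover have "t0 \<in> ?K"
    using t0 \<delta>(2) [of t0] by force
  ultimately obtain t where t: "t \<in> ?K" "\<And>s. s \<in> ?K \<Longrightarrow> t \<le> s"
    using compact_attains_inf [of ?K] by blast
  have none: "\<Phi> (x, s) \<notin> S" if "0 < s" "s < t" for s
    using that t(1) t(2) [of s] \<delta>(2) [of s] by (cases "s \<le> \<delta>") auto
  have eq: "first_return_time \<Phi> S x = t"
    by (rule first_return_time_eqI) (use t \<delta>(1) none in auto)
  show "first_return_time \<Phi> S x > 0" "\<Phi> (x, first_return_time \<Phi> S x) \<in> S"
    using t \<delta>(1) by (auto simp: eq)
  show "\<And>s. \<lbrakk>0 < s; s < first_return_time \<Phi> S x\<rbrakk> \<Longrightarrow> \<Phi> (x, s) \<notin> S"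
    using none by (simp add: eq)
qed

text \<open>
  On a whole neighbourhood of \<open>x\<close> in \<open>S\<close> there are no returns up to some time \<open>\<delta>\<close>, and the
  rest \<open>[\<delta>, a]\<close> of the time interval is compact, so the tube lemma keeps nearby orbits in the
  complement of \<open>S\<close> there.
\<close>

lemma first_return_time_lsc:
  assumes x: "x \<in> S" and a: "a < first_return_time \<Phi> S x"
  shows "\<exists>N. openin X N \<and> x \<in> N \<and> (\<forall>y \<in> N \<inter> S. a < first_return_time \<Phi> S y)"
proof -
  have xX: "x \<in> topspace X" using x section_subset by blast
  obtain V \<delta> where V: "openin X V" "x \<in> V" "\<delta> > 0"
      "\<And>y t. \<lbrakk>y \<in> V \<inter> S; t \<noteq> 0; \<bar>t\<bar> \<le> \<delta>\<rbrakk> \<Longrightarrow> \<Phi> (y, t) \<notin> S"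
    using isolated [OF x] by blast
  have "openin X (topspace X - S)" using section_closed by blast
  moreover have "\<Phi> (x, t) \<in> topspace X - S" if "t \<in> {\<delta>..a}" for t
    using first_return(3) [OF x, of t] that a V(3) flow_in_topspace [OF xX] by auto
  ultimately obtain N where N: "openin X N" "x \<in> N"
      "\<And>y t. \<lbrakk>y \<in> N; t \<in> {\<delta>..a}\<rbrakk> \<Longrightarrow> \<Phi> (y, t) \<in> topspace X - S"
    using orbit_tube [OF xX compact_Icc, of "topspace X - S" \<delta> a] by blast
  have "a < first_return_time \<Phi> S y" if y: "y \<in> V \<inter> N \<inter> S" for y
  proof (rule ccontr)
    assume "\<not> a < first_return_time \<Phi> S y"
    with first_return(1,2) [of y] y V(4) [of y "first_return_time \<Phi> S y"]
      N(3) [of y "first_return_time \<Phi> S y"] show False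
      by (cases "first_return_time \<Phi> S y \<le> \<delta>") auto
  qed
  then show ?thesis using V N by (intro exI [of _ "V \<inter> N"]) auto
qed

text \<open>
  Shortly before and shortly after its return, the orbit of \<open>x\<close> lies in the two different open
  sides \<open>A\<close> and \<open>B\<close> of \<open>S\<close>.  Nearby orbits do likewise and stay in \<open>U\<close> in between, so the
  connectedness of the time interval forces them to meet \<open>S\<close>.
\<close>

lemma first_return_time_usc:
  assumes x: "x \<in> S" and a: "first_return_time \<Phi> S x < a"
  shows "\<exists>N. openin X N \<and> x \<in> N \<and> (\<forall>y \<in> N \<inter> S. first_return_time \<Phi> S y < a)"
proof -
  define T where "T = first_return_time \<Phi> S x"
  have T: "T > 0" "\<Phi> (x, T) \<in> S" "T < a"
    using first_return [OF x] a by (auto simp: T_def)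
  have xX: "x \<in> topspace X" using x section_subset by blast
  have shift: "\<Phi> (\<Phi> (x, T), s) = \<Phi> (x, T + s)" for s
    using flow_add [OF xX] .
  obtain U A B \<epsilon> where U: "openin X U" "\<Phi> (x, T) \<in> U" "openin X A" "openin X B" "A \<inter> B = {}"
      "U - S = A \<union> B" "\<epsilon> > 0"
      "\<And>t. \<lbrakk>- \<epsilon> \<le> t; t < 0\<rbrakk> \<Longrightarrow> \<Phi> (x, T + t) \<in> A"
      "\<And>t. \<lbrakk>0 < t; t \<le> \<epsilon>\<rbrakk> \<Longrightarrow> \<Phi> (x, T + t) \<in> B"
    using crossing [OF T(2)] unfolding shift by blast
  have "open {t. \<Phi> (x, t) \<in> U}"
    using openin_continuous_map_preimage [OF orbit_continuous [OF xX] U(1)] by simp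
  then obtain \<rho> where \<rho>: "\<rho> > 0" "\<And>t. \<bar>t - T\<bar> < \<rho> \<Longrightarrow> \<Phi> (x, t) \<in> U"
    using U(2) by (force simp: open_dist dist_real_def)
  (* Keep the time window within the crossing, inside U, at positive times and before a. *)
  define \<eta> where "\<eta> = Min {\<epsilon>, \<rho> / 2, T / 2, (a - T) / 2}"
  have "0 < \<eta>" using U(7) \<rho>(1) T by (simp add: \<eta>_def)
  moreover have "\<eta> \<le> \<epsilon>" "\<eta> \<le> \<rho> / 2" "\<eta> \<le> T / 2" "\<eta> \<le> (a - T) / 2"
    unfolding \<eta>_def by (rule Min_le; simp)+
  ultimately have \<eta>: "0 < \<eta>" "\<eta> \<le> \<epsilon>" "\<eta> < \<rho>" "\<eta> < T" "T + \<eta> < a"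
    using \<rho>(1) T by auto
  have "\<Phi> (x, t) \<in> U" if "t \<in> {T - \<eta>..T + \<eta>}" for t
    using \<rho>(2) [of t] \<eta>(3) that by auto
  then obtain N1 where N1: "openin X N1" "x \<in> N1"
      "\<And>y t. \<lbrakk>y \<in> N1; t \<in> {T - \<eta>..T + \<eta>}\<rbrakk> \<Longrightarrow> \<Phi> (y, t) \<in> U"
    using orbit_tube [OF xX compact_Icc U(1)] by blast
  obtain N2 where N2: "openin X N2" "x \<in> N2" "\<And>y. y \<in> N2 \<Longrightarrow> \<Phi> (y, T - \<eta>) \<in> A"
    by (rule orbit_tube [OF xX, of "{T - \<eta>}" A]) (use U(3) U(8) [of "- \<eta>"] \<eta> in simp_all)
  obtain N3 where N3: "openin X N3" "x \<in> N3" "\<And>y. y \<in> N3 \<Longrightarrow> \<Phi> (y, T + \<eta>) \<in> B"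
    by (rule orbit_tube [OF xX, of "{T + \<eta>}" B]) (use U(4) U(9) [of \<eta>] \<eta> in simp_all)
  have "first_return_time \<Phi> S y < a" if y: "y \<in> N1" "y \<in> N2" "y \<in> N3" "y \<in> S" for y
  proof (rule ccontr)
    assume late: "\<not> first_return_time \<Phi> S y < a"
    let ?I = "{T - \<eta>..T + \<eta>}"
    have yX: "y \<in> topspace X" using y section_subset by blast
    have "\<Phi> (y, t) \<in> A \<union> B" if "t \<in> ?I" for t
      using N1(3) [OF y(1) that] first_return(3) [OF y(4), of t] late that \<eta> U(6) by force
    then have "(\<lambda>t. \<Phi> (y, t)) ` ?I \<subseteq> A \<union> B" by blast
    moreover have "connectedin X ((\<lambda>t. \<Phi> (y, t)) ` ?I)"
      by (rule connectedin_continuous_map_image [OF orbit_continuous [OF yX]]) simp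
    moreover have "A \<inter> (\<lambda>t. \<Phi> (y, t)) ` ?I \<noteq> {}" "B \<inter> (\<lambda>t. \<Phi> (y, t)) ` ?I \<noteq> {}"
      using N2(3) [OF y(2)] N3(3) [OF y(3)] \<eta>(1) by force+
    ultimately show False
      using U(3-5) unfolding connectedin by blast
  qed
  then show ?thesis
    using N1 N2 N3 by (intro exI [of _ "N1 \<inter> N2 \<inter> N3"]) auto
qed

lemma first_return_time_continuous:
  "continuous_map (subtopology X S) euclideanreal (first_return_time \<Phi> S)"
proof -
  (* A condition on points of S that is stable near each of them is relatively open. *)
  have op: "openin (subtopology X S) {x \<in> topspace (subtopology X S). Q x}"
    if stable: "\<And>x. \<lbrakk>x \<in> S; Q x\<rbrakk> \<Longrightarrow> \<exists>N. openin X N \<and> x \<in> N \<and> (\<forall>y \<in> N \<inter> S. Q y)" for Q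
  proof (subst openin_subopen, intro ballI)
    fix x assume "x \<in> {x \<in> topspace (subtopology X S). Q x}"
    then obtain N where N: "openin X N" "x \<in> N \<inter> S" "\<forall>y \<in> N \<inter> S. Q y"
      using stable [of x] by auto
    moreover have "N \<inter> S \<subseteq> {x \<in> topspace (subtopology X S). Q x}"
      using N openin_subset by auto
    ultimately show "\<exists>W. openin (subtopology X S) W \<and> x \<in> W \<and>
        W \<subseteq> {x \<in> topspace (subtopology X S). Q x}"
      by (intro exI [of _ "N \<inter> S"]) (auto simp: openin_subtopology)
  qed
  show ?thesis
    unfolding continuous_map_upper_lower_semicontinuous_lt
    using op first_return_time_lsc first_return_time_usc by simp
qed

lemma poincare_map_continuous:
  "continuous_map (subtopology X S) (subtopology X S) (poincare_map \<Phi> S)"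
proof -
  have "continuous_map (subtopology X S) (prod_topology X euclideanreal)
      (\<lambda>x. (x, first_return_time \<Phi> S x))"
    using first_return_time_continuous
    by (simp add: continuous_map_pairedI continuous_map_from_subtopology)
  then have "continuous_map (subtopology X S) X (\<lambda>x. \<Phi> (x, first_return_time \<Phi> S x))"
    using continuous_map_compose [OF _ flow_continuous] by (simp add: o_def)
  then have "continuous_map (subtopology X S) X (poincare_map \<Phi> S)"
    by (rule continuous_map_eq) (simp add: poincare_map_def)
  then show ?thesis
    using first_return(2) by (auto simp: continuous_map_in_subtopology poincare_map_def)
qed

lemma reverse_cross_section: "cross_section (\<lambda>(x, t). \<Phi> (x, - t)) X S"
proof
  have "continuous_map (prod_topology X euclideanreal) (prod_topology X euclideanreal)
      (\<lambda>p. (fst p, - snd p))"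
    by (intro continuous_map_pairedI continuous_map_minus continuous_map_fst continuous_map_snd)
  from continuous_map_compose [OF this flow_continuous]
  show "continuous_map (prod_topology X euclideanreal) X (\<lambda>(x, t). \<Phi> (x, - t))"
    by (simp add: o_def case_prod_unfold)
next
  fix x assume x: "x \<in> S"
  obtain V \<delta> where V: "openin X V" "x \<in> V" "\<delta> > 0"
      "\<And>y t. \<lbrakk>y \<in> V \<inter> S; t \<noteq> 0; \<bar>t\<bar> \<le> \<delta>\<rbrakk> \<Longrightarrow> \<Phi> (y, t) \<notin> S"
    using isolated [OF x] by blast
  then show "\<exists>V \<delta>. openin X V \<and> x \<in> V \<and> 0 < \<delta> \<and> (\<forall>y\<in>V \<inter> S. \<forall>t.
      t \<noteq> 0 \<and> \<bar>t\<bar> \<le> \<delta> \<longrightarrow> (case (y, t) of (x, t) \<Rightarrow> \<Phi> (x, - t)) \<notin> S)"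
    by (intro exI [of _ V] exI [of _ \<delta>]) auto
next
  fix x assume x: "x \<in> S"
  obtain U A B \<epsilon> where U: "openin X U" "x \<in> U" "openin X A" "openin X B" "A \<inter> B = {}"
      "U - S = A \<union> B" "\<epsilon> > 0" "\<And>t. \<lbrakk>- \<epsilon> \<le> t; t < 0\<rbrakk> \<Longrightarrow> \<Phi> (x, t) \<in> A"
      "\<And>t. \<lbrakk>0 < t; t \<le> \<epsilon>\<rbrakk> \<Longrightarrow> \<Phi> (x, t) \<in> B"
    using crossing [OF x] by blast
  have "B \<inter> A = {}" "U - S = B \<union> A" using U(5,6) by auto
  moreover have "\<Phi> (x, - t) \<in> B" if "- \<epsilon> \<le> t" "t < 0" for t
    using U(9) [of "- t"] that by simp
  moreover have "\<Phi> (x, - t) \<in> A" if "0 < t" "t \<le> \<epsilon>" for t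
    using U(8) [of "- t"] that by simp
  (* Time reversal exchanges the two sides. *)
  ultimately show "\<exists>U A B \<epsilon>. openin X U \<and> x \<in> U \<and> openin X A \<and> openin X B \<and> A \<inter> B = {} \<and>
      U - S = A \<union> B \<and> 0 < \<epsilon> \<and>
      (\<forall>t. - \<epsilon> \<le> t \<and> t < 0 \<longrightarrow> (case (x, t) of (x, t) \<Rightarrow> \<Phi> (x, - t)) \<in> A) \<and>
      (\<forall>t. 0 < t \<and> t \<le> \<epsilon> \<longrightarrow> (case (x, t) of (x, t) \<Rightarrow> \<Phi> (x, - t)) \<in> B)"
    using U(1-4,7)
    by (intro exI [of _ U] exI [of _ B] exI [of _ A] exI [of _ \<epsilon>] conjI allI impI) simp_all
next
  fix x assume x: "x \<in> topspace X"
  show "\<exists>t>0. (case (x, t) of (x, t) \<Rightarrow> \<Phi> (x, - t)) \<in> S"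
  proof -
    obtain t where "t < 0" "\<Phi> (x, t) \<in> S" using backward_return [OF x] by blast
    then show ?thesis by (intro exI [of _ "- t"]) simp
  qed
  show "\<exists>t<0. (case (x, t) of (x, t) \<Rightarrow> \<Phi> (x, - t)) \<in> S"
  proof -
    obtain t where "t > 0" "\<Phi> (x, t) \<in> S" using forward_return [OF x] by blast
    then show ?thesis by (intro exI [of _ "- t"]) simp
  qed
qed (use flow_0 flow_add section_closed in auto)

text \<open>
  Running back from the first return point, the orbit traverses the same segment, whose interior
  avoids \<open>S\<close>, and so first returns to its starting point.
\<close>

lemma poincare_map_reverse:
  assumes x: "x \<in> S"
  shows "poincare_map (\<lambda>(x, t). \<Phi> (x, - t)) S (poincare_map \<Phi> S x) = x"
proof -
  define T where "T = first_return_time \<Phi> S x"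
  have T: "T > 0" "\<Phi> (x, T) \<in> S" "\<And>s. \<lbrakk>0 < s; s < T\<rbrakk> \<Longrightarrow> \<Phi> (x, s) \<notin> S"
    using first_return [OF x] by (auto simp: T_def)
  have xX: "x \<in> topspace X" using x section_subset by blast
  have rewind: "\<Phi> (\<Phi> (x, T), - s) = \<Phi> (x, T - s)" for s
    using flow_add [OF xX, of T "- s"] by simp
  have "first_return_time (\<lambda>(x, t). \<Phi> (x, - t)) S (\<Phi> (x, T)) = T"
    by (rule first_return_time_eqI) (use T x flow_0 [OF xX] in \<open>auto simp: rewind\<close>)
  then show ?thesis
    using x T(2) flow_0 [OF xX] rewind [of T] by (simp add: poincare_map_def flip: T_def)
qed

lemma poincare_map_homeomorphic:
  "homeomorphic_map (subtopology X S) (subtopology X S) (poincare_map \<Phi> S)"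
proof -
  interpret rev: cross_section "\<lambda>(x, t). \<Phi> (x, - t)" X S
    by (rule reverse_cross_section)
  have "(\<lambda>(x, t). (case (x, - t) of (x, t) \<Rightarrow> \<Phi> (x, - t))) = \<Phi>"
    by auto
  then have "poincare_map \<Phi> S (poincare_map (\<lambda>(x, t). \<Phi> (x, - t)) S x) = x" if "x \<in> S" for x
    using rev.poincare_map_reverse [OF that] by simp
  then have "homeomorphic_maps (subtopology X S) (subtopology X S)
      (poincare_map \<Phi> S) (poincare_map (\<lambda>(x, t). \<Phi> (x, - t)) S)"
    using poincare_map_continuous rev.poincare_map_continuous poincare_map_reverse
    by (simp add: homeomorphic_maps_def)
  then show ?thesis by (rule homeomorphic_maps_imp_map)
qed

end

lemma global_section_submanifold:
  assumes "global_section \<Phi> X S"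
  shows "\<exists>k. submanifold_of_dim k X S"
proof -
  obtain n where "topologically_transversal n \<Phi> X S"
    using assms unfolding global_section_def by blast
  from this [unfolded topologically_transversal_def, THEN conjunct1] show ?thesis by blast
qed

lemma global_section_closed: "global_section \<Phi> X S \<Longrightarrow> closedin X S"
  using global_section_submanifold by (fastforce simp: submanifold_of_dim_def)

text \<open>
  Components of the open set \<open>U - S\<close> are open, because manifolds are locally connected.  The
  component \<open>C\<close> that the orbit leaves and the rest of \<open>U - S\<close>, which contains the component that
  it enters, form the open partition.
\<close>

lemma global_section_cross_section:
  assumes flow: "is_flow \<Phi> X" and glob: "global_section \<Phi> X S"
  shows "cross_section \<Phi> X S"
proof -
  obtain n where n: "manifold_of_dim n X" "topologically_transversal n \<Phi> X S"
    and ret: "\<forall>x \<in> topspace X. (\<exists>t>0. \<Phi> (x, t) \<in> S) \<and> (\<exists>t<0. \<Phi> (x, t) \<in> S)"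
    using glob unfolding global_section_def by blast
  have closed: "closedin X S"
    using glob by (rule global_section_closed)
  obtain \<delta>\<^sub>p \<delta>\<^sub>m where \<delta>: "\<forall>x \<in> S. \<delta>\<^sub>p x > (0::real) \<and> \<delta>\<^sub>m x < (0::real) \<and>
        (\<exists>U \<phi>. openin X U \<and> x \<in> U \<and>
           homeomorphic_map (subtopology X U)
             (subtopology (Euclidean_space n) (unit_ball n)) \<phi> \<and>
           \<phi> ` (U \<inter> S) = unit_ball n \<inter> topspace (Euclidean_space (n - 1)) \<and>
           (\<exists>C \<in> connected_components_of (subtopology X (U - S)).
            \<exists>D \<in> connected_components_of (subtopology X (U - S)).
              C \<noteq> D \<and>
              \<Phi> ` ({x} \<times> {\<delta>\<^sub>m x..<0}) \<subseteq> C \<and>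
              \<Phi> ` ({x} \<times> {0<..\<delta>\<^sub>p x}) \<subseteq> D) \<and>
           \<Phi> ` ({x} \<times> {\<delta>\<^sub>m x..\<delta>\<^sub>p x}) \<inter> S = {x} \<and>
           (\<exists>V \<delta>. openin X V \<and> x \<in> V \<and> V \<subseteq> U \<and> \<delta> > 0 \<and>
              (\<forall>y \<in> V \<inter> S. \<delta>\<^sub>p y > \<delta> \<and> \<delta>\<^sub>m y < - \<delta>)))"
    using n(2) [unfolded topologically_transversal_def, THEN conjunct2, THEN conjunct1]
    by (elim exE) (rule that)
  have signs: "\<delta>\<^sub>p x > 0" "\<delta>\<^sub>m x < 0" if "x \<in> S" for x
    using bspec [OF \<delta> that, THEN conjunct1]
      bspec [OF \<delta> that, THEN conjunct2, THEN conjunct1] .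
  have sides: "\<exists>U C D. openin X U \<and> x \<in> U \<and> C \<in> connected_components_of (subtopology X (U - S)) \<and>
      D \<in> connected_components_of (subtopology X (U - S)) \<and> C \<noteq> D \<and>
      (\<forall>t \<in> {\<delta>\<^sub>m x..<0}. \<Phi> (x, t) \<in> C) \<and> (\<forall>t \<in> {0<..\<delta>\<^sub>p x}. \<Phi> (x, t) \<in> D)"
    if x: "x \<in> S" for x
  proof -
    obtain U C D where "openin X U" "x \<in> U" "C \<in> connected_components_of (subtopology X (U - S))"
      "D \<in> connected_components_of (subtopology X (U - S))" "C \<noteq> D"
      "\<Phi> ` ({x} \<times> {\<delta>\<^sub>m x..<0}) \<subseteq> C" "\<Phi> ` ({x} \<times> {0<..\<delta>\<^sub>p x}) \<subseteq> D"
      using bspec [OF \<delta> x] by (elim conjE exE bexE) (rule that)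
    then show ?thesis
      by (intro exI [of _ U] exI [of _ C] exI [of _ D] conjI ballI) (simp_all add: image_subset_iff)
  qed
  have unif: "\<exists>V \<delta>. openin X V \<and> x \<in> V \<and> \<delta> > 0 \<and> (\<forall>y \<in> V \<inter> S. \<delta>\<^sub>p y > \<delta> \<and> \<delta>\<^sub>m y < - \<delta>)"
    if x: "x \<in> S" for x
    using bspec [OF \<delta> x] by (elim conjE exE bexE) blast
  (* Meeting S in the point x only would still allow the segment to pass through x again at a
     later time; lying in components of U - S excludes this. *)
  have off: "\<Phi> (x, t) \<notin> S" if x: "x \<in> S" and "t \<noteq> 0" "\<delta>\<^sub>m x \<le> t" "t \<le> \<delta>\<^sub>p x" for x t
  proof -
    obtain U C D where UCD: "C \<in> connected_components_of (subtopology X (U - S))"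
      "D \<in> connected_components_of (subtopology X (U - S))"
      "\<forall>t \<in> {\<delta>\<^sub>m x..<0}. \<Phi> (x, t) \<in> C" "\<forall>t \<in> {0<..\<delta>\<^sub>p x}. \<Phi> (x, t) \<in> D"
      using sides [OF x] by blast
    have "C \<inter> S = {}" "D \<inter> S = {}"
      using UCD(1,2) [THEN connected_components_of_subset] by auto
    moreover have "\<Phi> (x, t) \<in> C \<union> D"
      using UCD(3,4) that by (cases "t < 0") auto
    ultimately show ?thesis by blast
  qed
  have isol: "\<exists>V \<delta>. openin X V \<and> x \<in> V \<and> \<delta> > 0 \<and>
      (\<forall>y \<in> V \<inter> S. \<forall>t. t \<noteq> 0 \<and> \<bar>t\<bar> \<le> \<delta> \<longrightarrow> \<Phi> (y, t) \<notin> S)" if x: "x \<in> S" for x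
  proof -
    obtain V \<delta> where V: "openin X V" "x \<in> V" "\<delta> > 0" "\<forall>y \<in> V \<inter> S. \<delta>\<^sub>p y > \<delta> \<and> \<delta>\<^sub>m y < - \<delta>"
      using unif [OF x] by blast
    have "\<Phi> (y, t) \<notin> S" if "y \<in> V \<inter> S" "t \<noteq> 0" "\<bar>t\<bar> \<le> \<delta>" for y t
      using off [of y t] V(4) that by force
    then show ?thesis using V(1-3) by blast
  qed
  have cross: "\<exists>U A B \<epsilon>. openin X U \<and> x \<in> U \<and> openin X A \<and> openin X B \<and>
      A \<inter> B = {} \<and> U - S = A \<union> B \<and> \<epsilon> > 0 \<and>
      (\<forall>t. - \<epsilon> \<le> t \<and> t < 0 \<longrightarrow> \<Phi> (x, t) \<in> A) \<and> (\<forall>t. 0 < t \<and> t \<le> \<epsilon> \<longrightarrow> \<Phi> (x, t) \<in> B)"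
    if x: "x \<in> S" for x
  proof -
    obtain U C D where U: "openin X U" "x \<in> U"
      and C: "C \<in> connected_components_of (subtopology X (U - S))"
      and D: "D \<in> connected_components_of (subtopology X (U - S))" and "C \<noteq> D"
      and CD: "\<forall>t \<in> {\<delta>\<^sub>m x..<0}. \<Phi> (x, t) \<in> C" "\<forall>t \<in> {0<..\<delta>\<^sub>p x}. \<Phi> (x, t) \<in> D"
      using sides [OF x] by blast
    have US: "openin X (U - S)" using U(1) closed by (simp add: openin_diff)
    then have top: "topspace (subtopology X (U - S)) = U - S"
      by (intro topspace_subtopology_subset openin_subset)
    have openC: "openin X C"
      using manifold_of_dim_locally_connected [OF n(1)] US C
      unfolding locally_connected_space_open_connected_components by blast
    have openR: "openin X (U - S - C)"
      using closedin_connected_components_of [OF C] US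
      by (metis closedin_def openin_open_subtopology top)
    have sub: "C \<subseteq> U - S" "D \<subseteq> U - S"
      using C D connected_components_of_subset top by metis+
    have disj: "C \<inter> D = {}"
      using pairwise_disjoint_connected_components_of [of "subtopology X (U - S)"] C D \<open>C \<noteq> D\<close>
      unfolding pairwise_def disjnt_def by blast
    define \<epsilon> where "\<epsilon> = min (\<delta>\<^sub>p x) (- \<delta>\<^sub>m x)"
    have "\<epsilon> > 0" using signs [OF x] by (simp add: \<epsilon>_def)
    moreover have "\<Phi> (x, t) \<in> C" if "- \<epsilon> \<le> t" "t < 0" for t
      using CD(1) that by (simp add: \<epsilon>_def min_def split: if_splits)
    moreover have "\<Phi> (x, t) \<in> U - S - C" if "0 < t" "t \<le> \<epsilon>" for t
    proof -
      have "\<Phi> (x, t) \<in> D" using CD(2) that by (simp add: \<epsilon>_def)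
      then show ?thesis using sub disj by blast
    qed
    moreover have "C \<inter> (U - S - C) = {}" "U - S = C \<union> (U - S - C)"
      using sub by blast+
    ultimately show ?thesis using U openC openR
      by (intro exI [of _ U] exI [of _ C] exI [of _ "U - S - C"] exI [of _ \<epsilon>]) simp
  qed
  show ?thesis
  proof
    show "continuous_map (prod_topology X euclideanreal) X \<Phi>"
      "\<And>x. x \<in> topspace X \<Longrightarrow> \<Phi> (x, 0) = x"
      "\<And>x t s. x \<in> topspace X \<Longrightarrow> \<Phi> (\<Phi> (x, t), s) = \<Phi> (x, t + s)"
      using flow unfolding is_flow_def by blast+
    show "\<And>x. x \<in> topspace X \<Longrightarrow> \<exists>t>0. \<Phi> (x, t) \<in> S"
      "\<And>x. x \<in> topspace X \<Longrightarrow> \<exists>t<0. \<Phi> (x, t) \<in> S"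
      using ret by blast+
  qed (fact closed isol cross)+
qed

section \<open>Weak morphisms and Poincare maps\<close>

text \<open>
  Every time strictly between \<open>0\<close> and \<open>\<tau> (x, T x)\<close> is \<open>\<tau> (x, t)\<close> for some \<open>t\<close> strictly
  between \<open>0\<close> and \<open>T x\<close>, and at such \<open>t\<close> the orbit of \<open>x\<close> is outside \<open>S = h\<^sup>-\<^sup>1(S')\<close>.  Hence
  the first return time of \<open>h x\<close> is \<open>\<tau> (x, T x)\<close>.
\<close>

lemma weak_morphism_poincare:
  assumes "cross_section \<Phi> X S" and w: "weak_morphism \<Phi> X \<Psi> Y h \<tau>"
    and S: "S = {x \<in> topspace X. h x \<in> S'}" and x: "x \<in> S"
  shows "h (poincare_map \<Phi> S x) = poincare_map \<Psi> S' (h x)"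
proof -
  interpret cross_section \<Phi> X S by fact
  define T where "T = first_return_time \<Phi> S x"
  have T: "T > 0" "\<Phi> (x, T) \<in> S" "\<And>s. \<lbrakk>0 < s; s < T\<rbrakk> \<Longrightarrow> \<Phi> (x, s) \<notin> S"
    using first_return [OF x] by (auto simp: T_def)
  have xX: "x \<in> topspace X" using x section_subset by blast
  have mono: "strict_mono (\<lambda>t. \<tau> (x, t))" and \<tau>0: "\<tau> (x, 0) = 0"
    and homeo: "homeomorphic_map euclideanreal euclideanreal (\<lambda>t. \<tau> (x, t))"
    and h\<Phi>: "\<And>t. h (\<Phi> (x, t)) = \<Psi> (h x, \<tau> (x, t))"
    using w xX unfolding weak_morphism_def by auto
  have surj: "range (\<lambda>t. \<tau> (x, t)) = UNIV"
    using homeomorphic_imp_surjective_map [OF homeo] by simp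
  have less: "\<tau> (x, s) < \<tau> (x, t) \<longleftrightarrow> s < t" for s t
    using strict_mono_less [OF mono] .
  have "first_return_time \<Psi> S' (h x) = \<tau> (x, T)"
  proof (rule first_return_time_eqI)
    show "\<tau> (x, T) > 0" using less [of 0 T] T(1) \<tau>0 by simp
    show "\<Psi> (h x, \<tau> (x, T)) \<in> S'" using T(2) h\<Phi> [of T] S by auto
  next
    fix s assume s: "0 < s" "s < \<tau> (x, T)"
    obtain t where t: "s = \<tau> (x, t)" using surj by (metis UNIV_I imageE)
    then have "0 < t" "t < T" using s less [of 0 t] less [of t T] \<tau>0 by auto
    then have "\<Phi> (x, t) \<notin> S" using T(3) by blast
    then show "\<Psi> (h x, s) \<notin> S'"
      using flow_in_topspace [OF xX] h\<Phi> [of t] S t by auto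
  qed
  moreover have "h x \<in> S'" using x S by blast
  ultimately show ?thesis
    using x h\<Phi> [of T] by (simp add: poincare_map_def flip: T_def)
qed

section \<open>The categories and the functor\<close>

lemma MapDS_simps [simp]:
  "(f, X) \<in> Obj MapDS \<longleftrightarrow>
     topological_manifold X \<and> f \<in> extensional (topspace X) \<and> homeomorphic_map X X f"
  "h \<in> Hom MapDS (f, X) (g, Y) \<longleftrightarrow> h \<in> extensional (topspace X) \<and>
     continuous_map X Y h \<and> (\<forall>x \<in> topspace X. h (f x) = g (h x))"
  "Id MapDS (f, X) = (\<lambda>x \<in> topspace X. x)"
  "Comp MapDS (f, X) B D h\<^sub>2 h\<^sub>1 = compose (topspace X) h\<^sub>2 h\<^sub>1"
  by (simp_all add: MapDS_def)

lemma WFlowGS_simps [simp]: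
  "(\<Phi>, X, S) \<in> Obj WFlowGS \<longleftrightarrow> is_flow \<Phi> X \<and> global_section \<Phi> X S"
  "(h, \<tau>) \<in> Hom WFlowGS (\<Phi>, X, S) (\<Psi>, Y, S') \<longleftrightarrow>
     weak_morphism \<Phi> X \<Psi> Y h \<tau> \<and> S = {x \<in> topspace X. h x \<in> S'}"
  "Id WFlowGS (\<Phi>, X, S) = (\<lambda>x \<in> topspace X. x, \<lambda>(x, t) \<in> topspace X \<times> UNIV. t)"
  "Comp WFlowGS (\<Phi>, X, S) B D (h\<^sub>2, \<tau>\<^sub>2) (h\<^sub>1, \<tau>\<^sub>1) = (compose (topspace X) h\<^sub>2 h\<^sub>1,
     \<lambda>(x, t) \<in> topspace X \<times> UNIV. \<tau>\<^sub>2 (h\<^sub>1 x, \<tau>\<^sub>1 (x, t)))"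
  by (simp_all add: WFlowGS_def)

lemma continuous_map_restrict_id: "continuous_map X X (\<lambda>x \<in> topspace X. x)"
  by (rule continuous_map_eq [OF continuous_map_id]) simp

lemma continuous_map_compose_on:
  assumes "continuous_map X Y f" "continuous_map Y Z g"
  shows "continuous_map X Z (compose (topspace X) g f)"
  by (rule continuous_map_eq [OF continuous_map_compose [OF assms]]) (simp add: compose_def)

lemma continuous_map_mem:
  "\<lbrakk>continuous_map X Y f; x \<in> topspace X\<rbrakk> \<Longrightarrow> f x \<in> topspace Y"
  by (auto simp: continuous_map_def Pi_iff)

lemma is_category_MapDS: "is_category MapDS"
  unfolding is_category_def
proof (intro conjI ballI)
  fix A :: "'a map_system" assume A: "A \<in> Obj MapDS"
  obtain f X where [simp]: "A = (f, X)" by (cases A)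
  have "f x \<in> topspace X" if "x \<in> topspace X" for x
    using A that continuous_map_mem homeomorphic_imp_continuous_map by force
  then show "Id MapDS A \<in> Hom MapDS A A"
    by (simp add: continuous_map_restrict_id)
next
  fix A B D :: "'a map_system" and h k
  assume A: "A \<in> Obj MapDS" and hk: "h \<in> Hom MapDS A B" "k \<in> Hom MapDS B D"
  obtain f X g Y d Z where [simp]: "A = (f, X)" "B = (g, Y)" "D = (d, Z)"
    by (cases A, cases B, cases D)
  have "f x \<in> topspace X" if "x \<in> topspace X" for x
    using A that continuous_map_mem homeomorphic_imp_continuous_map by force
  then show "Comp MapDS A B D k h \<in> Hom MapDS A D"
    using hk continuous_map_mem [of X Y h] continuous_map_compose_on [of X Y h Z k]
    by (simp add: compose_eq)
next
  fix A B :: "'a map_system" and h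
  assume h: "h \<in> Hom MapDS A B"
  obtain f X g Y where [simp]: "A = (f, X)" "B = (g, Y)"
    by (cases A, cases B)
  show "Comp MapDS A A B h (Id MapDS A) = h"
    using h by (auto simp: compose_def fun_eq_iff extensional_def)
  show "Comp MapDS A B B (Id MapDS B) h = h"
    using h continuous_map_mem [of X Y h] by (auto simp: compose_def fun_eq_iff extensional_def)
next
  fix A B D E :: "'a map_system" and h k l
  assume h: "h \<in> Hom MapDS A B"
  obtain f X g Y d Z where [simp]: "A = (f, X)" "B = (g, Y)" "D = (d, Z)"
    by (cases A, cases B, cases D)
  show "Comp MapDS A D E l (Comp MapDS A B D k h) = Comp MapDS A B E (Comp MapDS B D E l k) h"
    using h continuous_map_mem [of X Y h] by (auto simp: compose_def fun_eq_iff)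
qed

lemma flow_mem: "\<lbrakk>is_flow \<Phi> X; x \<in> topspace X\<rbrakk> \<Longrightarrow> \<Phi> (x, t) \<in> topspace X"
  by (auto simp: is_flow_def continuous_map_def Pi_iff)

lemma weak_morphism_mem:
  assumes "weak_morphism \<Phi> X \<Psi> Y h \<tau>" "x \<in> topspace X"
  shows "h x \<in> topspace Y"
proof -
  have "continuous_map X Y h" using assms(1) unfolding weak_morphism_def by (elim conjE)
  then show ?thesis using assms(2) by (rule continuous_map_mem)
qed

lemma weak_morphism_id:
  assumes "is_flow \<Phi> X"
  shows "weak_morphism \<Phi> X \<Phi> X (\<lambda>x \<in> topspace X. x) (\<lambda>(x, t) \<in> topspace X \<times> UNIV. t)"
proof -
  have "homeomorphic_map euclideanreal euclideanreal (\<lambda>t. t)"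
    using homeomorphic_map_id [of euclideanreal euclideanreal] by (simp add: id_def)
  moreover have "strict_mono (\<lambda>t. t :: real)" by (simp add: strict_mono_def)
  ultimately show ?thesis
    unfolding weak_morphism_def using flow_mem [OF assms] continuous_map_restrict_id
    by (intro conjI ballI allI) simp_all
qed

lemma weak_morphism_compose:
  assumes 1: "weak_morphism \<Phi> X \<Psi> Y h\<^sub>1 \<tau>\<^sub>1" and 2: "weak_morphism \<Psi> Y \<Xi> Z h\<^sub>2 \<tau>\<^sub>2"
    and flow: "is_flow \<Phi> X"
  shows "weak_morphism \<Phi> X \<Xi> Z (compose (topspace X) h\<^sub>2 h\<^sub>1)
    (\<lambda>(x, t) \<in> topspace X \<times> UNIV. \<tau>\<^sub>2 (h\<^sub>1 x, \<tau>\<^sub>1 (x, t)))"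
proof -
  have h1: "h\<^sub>1 x \<in> topspace Y" if "x \<in> topspace X" for x
    using weak_morphism_mem [OF 1 that] .
  have "continuous_map X Z (compose (topspace X) h\<^sub>2 h\<^sub>1)"
    using 1 2 continuous_map_compose_on unfolding weak_morphism_def by blast
  moreover have "compose (topspace X) h\<^sub>2 h\<^sub>1 (\<Phi> (x, t)) =
      \<Xi> (compose (topspace X) h\<^sub>2 h\<^sub>1 x, \<tau>\<^sub>2 (h\<^sub>1 x, \<tau>\<^sub>1 (x, t)))" if "x \<in> topspace X" for x t
    using 1 2 that h1 [OF that] flow_mem [OF flow that]
    by (simp add: weak_morphism_def compose_eq)
  moreover have "strict_mono (\<lambda>t. \<tau>\<^sub>2 (h\<^sub>1 x, \<tau>\<^sub>1 (x, t)))" "\<tau>\<^sub>2 (h\<^sub>1 x, \<tau>\<^sub>1 (x, 0)) = 0"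
    if "x \<in> topspace X" for x
    using 1 2 that h1 [OF that]
      strict_mono_compose [of "\<lambda>t. \<tau>\<^sub>2 (h\<^sub>1 x, t)" "\<lambda>t. \<tau>\<^sub>1 (x, t)"]
    by (simp_all add: weak_morphism_def o_def)
  moreover have "homeomorphic_map euclideanreal euclideanreal (\<lambda>t. \<tau>\<^sub>2 (h\<^sub>1 x, \<tau>\<^sub>1 (x, t)))"
    if "x \<in> topspace X" for x
    using homeomorphic_map_compose [of euclideanreal euclideanreal "\<lambda>t. \<tau>\<^sub>1 (x, t)" euclideanreal
        "\<lambda>t. \<tau>\<^sub>2 (h\<^sub>1 x, t)"] 1 2 that h1 [OF that]
    by (simp add: weak_morphism_def o_def)
  ultimately show ?thesis
    unfolding weak_morphism_def by simp
qed

lemma is_category_WFlowGS: "is_category WFlowGS"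
  unfolding is_category_def
proof (intro conjI ballI)
  fix A :: "'a sectioned_flow" assume A: "A \<in> Obj WFlowGS"
  obtain \<Phi> X S where [simp]: "A = (\<Phi>, X, S)" by (cases A)
  have "S \<subseteq> topspace X"
    using A global_section_closed closedin_subset by force
  then show "Id WFlowGS A \<in> Hom WFlowGS A A"
    using A by (auto simp: weak_morphism_id)
next
  fix A B D :: "'a sectioned_flow" and m n
  assume A: "A \<in> Obj WFlowGS" and mn: "m \<in> Hom WFlowGS A B" "n \<in> Hom WFlowGS B D"
  obtain \<Phi> X S \<Psi> Y S' \<Xi> Z S'' h \<tau> k \<sigma>
    where [simp]: "A = (\<Phi>, X, S)" "B = (\<Psi>, Y, S')" "D = (\<Xi>, Z, S'')" "m = (h, \<tau>)" "n = (k, \<sigma>)"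
    by (cases A, cases B, cases D, cases m, cases n)
  show "Comp WFlowGS A B D n m \<in> Hom WFlowGS A D"
    using A mn weak_morphism_mem [of \<Phi> X \<Psi> Y h \<tau>]
      weak_morphism_compose [of \<Phi> X \<Psi> Y h \<tau> \<Xi> Z k \<sigma>]
    by (auto simp: compose_eq)
next
  fix A B :: "'a sectioned_flow" and m
  assume m: "m \<in> Hom WFlowGS A B"
  obtain \<Phi> X S \<Psi> Y S' h \<tau> where [simp]: "A = (\<Phi>, X, S)" "B = (\<Psi>, Y, S')" "m = (h, \<tau>)"
    by (cases A, cases B, cases m)
  have ext: "h \<in> extensional (topspace X)" "\<tau> \<in> extensional (topspace X \<times> UNIV)"
    using m by (auto simp: weak_morphism_def)
  show "Comp WFlowGS A A B m (Id WFlowGS A) = m"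
    using ext by (auto simp: compose_def fun_eq_iff extensional_def)
  show "Comp WFlowGS A B B (Id WFlowGS B) m = m"
    using ext m weak_morphism_mem [of \<Phi> X \<Psi> Y h \<tau>]
    by (auto simp: compose_def fun_eq_iff extensional_def)
next
  fix A B D E :: "'a sectioned_flow" and m n l :: "'a flow_arrow"
  assume m: "m \<in> Hom WFlowGS A B"
  obtain \<Phi> X S \<Psi> Y S' \<Xi> Z S'' h \<tau> k \<sigma> j \<rho>
    where [simp]: "A = (\<Phi>, X, S)" "B = (\<Psi>, Y, S')" "D = (\<Xi>, Z, S'')" "m = (h, \<tau>)" "n = (k, \<sigma>)"
      "l = (j, \<rho>)"
    by (cases A, cases B, cases D, cases m, cases n, cases l)
  show "Comp WFlowGS A D E l (Comp WFlowGS A B D n m) =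
      Comp WFlowGS A B E (Comp WFlowGS B D E l n) m"
    using m weak_morphism_mem [of \<Phi> X \<Psi> Y h \<tau>] by (auto simp: compose_def fun_eq_iff)
qed

definition poincare_functor ::
  "('a sectioned_flow, 'a flow_arrow, 'a map_system, 'a \<Rightarrow> 'a) func" where
  "poincare_functor = \<lparr>
     obj_map = (\<lambda>(\<Phi>, X, S). (poincare_map \<Phi> S, subtopology X S)),
     hom_map = (\<lambda>(\<Phi>, X, S) B (h, \<tau>). restrict h S) \<rparr>"

lemma poincare_functor_simps [simp]:
  "obj_map poincare_functor (\<Phi>, X, S) = (poincare_map \<Phi> S, subtopology X S)"
  "hom_map poincare_functor (\<Phi>, X, S) B (h, \<tau>) = restrict h S"
  by (simp_all add: poincare_functor_def)

lemma topspace_section: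
  "global_section \<Phi> X S \<Longrightarrow> topspace (subtopology X S) = S"
  by (intro topspace_subtopology_subset closedin_subset global_section_closed)

lemma poincare_functor_obj:
  assumes "A \<in> Obj WFlowGS"
  shows "obj_map poincare_functor A \<in> Obj MapDS"
proof -
  obtain \<Phi> X S where A: "A = (\<Phi>, X, S)" by (cases A)
  then have flow: "is_flow \<Phi> X" and glob: "global_section \<Phi> X S" using assms by auto
  have "topological_manifold (subtopology X S)"
    using global_section_submanifold [OF glob]
    by (auto simp: submanifold_of_dim_def topological_manifold_def)
  moreover have "poincare_map \<Phi> S \<in> extensional S"
    by (simp add: poincare_map_def)
  ultimately show ?thesis
    using cross_section.poincare_map_homeomorphic [OF global_section_cross_section [OF flow glob]]
    by (simp add: A topspace_section [OF glob] del: topspace_subtopology)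
qed

lemma poincare_functor_hom:
  assumes "A \<in> Obj WFlowGS" "B \<in> Obj WFlowGS" "m \<in> Hom WFlowGS A B"
  shows "hom_map poincare_functor A B m \<in>
    Hom MapDS (obj_map poincare_functor A) (obj_map poincare_functor B)"
proof -
  obtain \<Phi> X S \<Psi> Y S' h \<tau> where [simp]: "A = (\<Phi>, X, S)" "B = (\<Psi>, Y, S')" "m = (h, \<tau>)"
    by (cases A, cases B, cases m)
  have glob: "global_section \<Phi> X S" and w: "weak_morphism \<Phi> X \<Psi> Y h \<tau>"
    and S: "S = {x \<in> topspace X. h x \<in> S'}"
    and cs: "cross_section \<Phi> X S"
    using assms global_section_cross_section by auto
  have "continuous_map (subtopology X S) Y (restrict h S)"
    by (rule continuous_map_eq [of _ _ h])
      (use w in \<open>auto simp: weak_morphism_def continuous_map_from_subtopology\<close>)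
  then have "continuous_map (subtopology X S) (subtopology Y S') (restrict h S)"
    using S by (auto simp: continuous_map_in_subtopology)
  moreover have "restrict h S (poincare_map \<Phi> S x) = poincare_map \<Psi> S' (restrict h S x)"
    if "x \<in> S" for x
  proof -
    have "poincare_map \<Phi> S x \<in> S"
      using cross_section.first_return(2) [OF cs that] that by (simp add: poincare_map_def)
    then show ?thesis
      using weak_morphism_poincare [OF cs w S that] that by simp
  qed
  ultimately show ?thesis
    by (simp add: topspace_section [OF glob] del: topspace_subtopology)
qed

lemma is_functor_poincare_functor: "is_functor WFlowGS MapDS poincare_functor"
  unfolding is_functor_def
proof (intro conjI ballI)
  fix A :: "'a sectioned_flow" assume A: "A \<in> Obj WFlowGS"
  obtain \<Phi> X S where [simp]: "A = (\<Phi>, X, S)" by (cases A)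
  have "S \<subseteq> topspace X"
    using A global_section_closed closedin_subset by force
  then show "hom_map poincare_functor A A (Id WFlowGS A) = Id MapDS (obj_map poincare_functor A)"
    by (auto simp: fun_eq_iff)
next
  fix A B E :: "'a sectioned_flow" and m n :: "'a flow_arrow"
  assume A: "A \<in> Obj WFlowGS" and m: "m \<in> Hom WFlowGS A B"
  obtain \<Phi> X S \<Psi> Y S' \<Xi> Z S'' h \<tau> k \<sigma>
    where [simp]: "A = (\<Phi>, X, S)" "B = (\<Psi>, Y, S')" "E = (\<Xi>, Z, S'')" "m = (h, \<tau>)" "n = (k, \<sigma>)"
    by (cases A, cases B, cases E, cases m, cases n)
  have S: "x \<in> S \<longleftrightarrow> x \<in> topspace X \<and> h x \<in> S'" for x
    using m by simp
  show "hom_map poincare_functor A E (Comp WFlowGS A B E n m) =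
    Comp MapDS (obj_map poincare_functor A) (obj_map poincare_functor B) (obj_map poincare_functor E)
      (hom_map poincare_functor B E n) (hom_map poincare_functor A B m)"
    using S by (simp add: compose_def fun_eq_iff)
qed (assumption | rule is_category_WFlowGS is_category_MapDS
    poincare_functor_obj poincare_functor_hom)+

theorem theorem3p12:
  shows "\<exists>P :: ('a sectioned_flow, 'a flow_arrow, 'a map_system, 'a \<Rightarrow> 'a) func.
    is_functor WFlowGS MapDS P \<and>
    (\<forall>\<Phi> X S. (\<Phi>, X, S) \<in> Obj WFlowGS \<longrightarrow>
       obj_map P (\<Phi>, X, S) = (poincare_map \<Phi> S, subtopology X S)) \<and>
    (\<forall>\<Phi>\<^sub>1 X\<^sub>1 S\<^sub>1 \<Phi>\<^sub>2 X\<^sub>2 S\<^sub>2 h \<tau>.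
       (\<Phi>\<^sub>1, X\<^sub>1, S\<^sub>1) \<in> Obj WFlowGS \<longrightarrow>
       (\<Phi>\<^sub>2, X\<^sub>2, S\<^sub>2) \<in> Obj WFlowGS \<longrightarrow>
       (h, \<tau>) \<in> Hom WFlowGS (\<Phi>\<^sub>1, X\<^sub>1, S\<^sub>1) (\<Phi>\<^sub>2, X\<^sub>2, S\<^sub>2) \<longrightarrow>
       hom_map P (\<Phi>\<^sub>1, X\<^sub>1, S\<^sub>1) (\<Phi>\<^sub>2, X\<^sub>2, S\<^sub>2) (h, \<tau>) = restrict h S\<^sub>1)"
  by (rule exI [of _ poincare_functor]) (simp add: is_functor_poincare_functor del: WFlowGS_simps)

end
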